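(* Let $\{X_t\}_{t=1}^T$ and $\{Y_t\}_{t=1}^T$ be nonnegative real sequences satisfying $$|X_t-Y_t|\le M_g\sum_{k=t+1}^TX_k^2$$ for $t=1,\dots,T$, with some constant $M_g>0$. If $X_T=Y_T$ and $X_t,Y_t\le G$ for all $t=1,\dots,T$, then $$\sum_{t=1}^TX_t^2\le\max\{e,\,4eM_g^2G^2T^2\}\sum_{t=1}^TY_t^2.$$
   Context: $e=\exp(1)$; an empty sum is $0$. *)

theory Defs
  imports Complex_Main
begin

end

theory Submission
  imports Defs
begin

text \<open>
  Write \<open>S\<close> and \<open>Q\<close> for the sums of squares of \<open>X\<close> and \<open>Y\<close>. If \<open>4 e M\<^sub>g\<^sup>2 T Q \<ge> 1\<close>, the trivial
  bound \<open>S \<le> T G\<^sup>2\<close> suffices. Otherwise \<open>(y + z)\<^sup>2 \<le> 3/2 y\<^sup>2 + 3 z\<^sup>2\<close> shows that the tail sums of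
  the \<open>X\<^sub>t\<^sup>2\<close> satisfy a discrete Riccati inequality, which is still far from blowing up after
  \<open>T\<close> steps because \<open>M\<^sub>g\<^sup>2 T Q\<close> is small, and it gives \<open>S \<le> e Q\<close>.
\<close>

text \<open>Induction on \<open>n\<close>: the right-hand side is a supersolution of the recursion,
  modelled on the solutions 1/(c - x) of y' = y^2. The assumption \<open>DN\<close> keeps every
  denominator positive up to step \<open>N\<close>.\<close>

lemma discrete_riccati_bound:
  fixes s p :: "nat \<Rightarrow> real" and d D :: real
  assumes "s 0 \<le> 0" and s: "\<And>n. 0 \<le> s n" and p: "\<And>n. 0 \<le> p n" and d: "0 \<le> d"
    and step: "\<And>n. n < N \<Longrightarrow> s (Suc n) \<le> s n + p n + d * (s n)\<^sup>2"
    and D: "D = d * (\<Sum>i<N. p i)" and DN: "real N * D < 1"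
    and "n \<le> N"
  shows "s n \<le> (\<Sum>i<n. p i) / (1 - real n * D)"
  using \<open>n \<le> N\<close>
proof (induction n)
  case 0
  then show ?case using assms(1) by simp
next
  case (Suc n)
  define u P where "u = 1 - real n * D" and "P = (\<Sum>i<n. p i)"
  have D0: "0 \<le> D" unfolding D using d p by (simp add: sum_nonneg)
  have "real (Suc n) * D \<le> real N * D"
    using Suc.prems D0 by (intro mult_right_mono) auto
  then have uD: "0 < u - D" "u - D \<le> 1"
    using DN D0 mult_nonneg_nonneg[of "real (Suc n)" D] by (auto simp: u_def algebra_simps)
  then have u: "0 < u" using D0 by simp
  have P0: "0 \<le> P" unfolding P_def by (simp add: p sum_nonneg)
  have "P \<le> (\<Sum>i<N. p i)"
    unfolding P_def using Suc.prems p by (intro sum_mono2) auto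
  then have dP: "d * P \<le> D" unfolding D using d by (rule mult_left_mono)
  have IH: "s n \<le> P / u" using Suc by (simp add: P_def u_def)
  have "d * (s n)\<^sup>2 \<le> d * (P / u)\<^sup>2"
    using IH s[of n] d by (intro mult_left_mono power_mono)
  also have "\<dots> = (d * P) * (P / u\<^sup>2)"
    by (simp add: power2_eq_square)
  \<comment> \<open>Bounding one factor \<open>P\<close> by the full sum makes the quadratic term
    linear in \<open>P\<close>.\<close>
  also have "\<dots> \<le> D * (P / u\<^sup>2)"
    using dP P0 by (intro mult_right_mono) auto
  finally have "s n + d * (s n)\<^sup>2 \<le> P / u + D * (P / u\<^sup>2)"
    using IH by simp
  also have "\<dots> = P * ((u + D) / u\<^sup>2)"
    using u by (simp add: field_simps power2_eq_square)
  \<comment> \<open>This is (u + D)(u - D) = u^2 - D^2 \<le> u^2.\<close>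
  also have "(u + D) / u\<^sup>2 \<le> 1 / (u - D)"
    using u uD by (simp add: divide_simps) (simp add: algebra_simps power2_eq_square)
  then have "P * ((u + D) / u\<^sup>2) \<le> P * (1 / (u - D))"
    using P0 by (rule mult_left_mono)
  finally have 1: "s n + d * (s n)\<^sup>2 \<le> P / (u - D)" by simp
  have 2: "p n \<le> p n / (u - D)"
    using uD p[of n] by (simp add: pos_le_divide_eq mult_left_le)
  have "s (Suc n) \<le> P / (u - D) + p n / (u - D)"
    using step[of n] Suc.prems 1 2 by simp
  also have "\<dots> = (P + p n) / (u - D)" by (simp add: add_divide_distrib)
  also have "u - D = 1 - real (Suc n) * D" by (simp add: u_def algebra_simps)
  finally show ?case by (simp add: P_def)
qed

text \<open>Squaring exp(1/2) \<ge> 1 + 1/2 + 1/8 = 13/8 gives 169/64 \<ge> 168/64. The value 21/8 =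
  3/2 + 9/8 is what the last estimate of the theorem requires.\<close>

lemma exp_1_ge: "21 / 8 \<le> exp (1 :: real)"
proof -
  have "(13 / 8)\<^sup>2 \<le> (exp (1 / 2 :: real))\<^sup>2"
    using exp_lower_Taylor_quadratic[of "1 / 2 :: real"]
    by (intro power_mono) (auto simp: power2_eq_square)
  also have "\<dots> = exp 1" by (simp flip: exp_double)
  finally show ?thesis by (simp add: power2_eq_square)
qed

theorem lemma2:
  fixes X Y :: "nat \<Rightarrow> real" and M\<^sub>g G :: real and T :: nat
  assumes "T \<ge> 1"
    and "\<And>t. t \<in> {1..T} \<Longrightarrow> X t \<ge> 0"
    and "\<And>t. t \<in> {1..T} \<Longrightarrow> Y t \<ge> 0"
    and "M\<^sub>g > 0"
    and "\<And>t. t \<in> {1..T} \<Longrightarrow> \<bar>X t - Y t\<bar> \<le> M\<^sub>g * (\<Sum>k = t+1..T. (X k)\<^sup>2)"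
    and "X T = Y T"
    and "\<And>t. t \<in> {1..T} \<Longrightarrow> X t \<le> G \<and> Y t \<le> G"
  shows "(\<Sum>t = 1..T. (X t)\<^sup>2)
    \<le> max (exp 1) (4 * exp 1 * M\<^sub>g\<^sup>2 * G\<^sup>2 * (real T)\<^sup>2) * (\<Sum>t = 1..T. (Y t)\<^sup>2)"
proof -
  define Q where "Q = (\<Sum>t = 1..T. (Y t)\<^sup>2)"
  define m where "m = max (exp 1) (4 * exp 1 * M\<^sub>g\<^sup>2 * G\<^sup>2 * (real T)\<^sup>2)"
  have Q0: "0 \<le> Q" unfolding Q_def by (simp add: sum_nonneg)
  have "(\<Sum>t = 1..T. (X t)\<^sup>2) \<le> m * Q"
  proof (cases "4 * exp 1 * (M\<^sub>g\<^sup>2 * real T * Q) \<ge> 1")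
    case True
    have "(\<Sum>t = 1..T. (X t)\<^sup>2) \<le> (\<Sum>t = 1..T. G\<^sup>2)"
      using assms(2,7) by (intro sum_mono power_mono) auto
    also have "\<dots> = real T * G\<^sup>2 * 1" by simp
    also have "\<dots> \<le> real T * G\<^sup>2 * (4 * exp 1 * (M\<^sub>g\<^sup>2 * real T * Q))"
      using True by (intro mult_left_mono) auto
    also have "\<dots> = 4 * exp 1 * M\<^sub>g\<^sup>2 * G\<^sup>2 * (real T)\<^sup>2 * Q"
      by (simp add: power2_eq_square)
    also have "\<dots> \<le> m * Q" unfolding m_def using Q0 by (intro mult_right_mono) auto
    finally show ?thesis .
  next
    case False
    \<comment> \<open>Time runs backwards: \<open>s n\<close> collects the last \<open>n\<close>
      squares, so \<open>s 0\<close> is an empty sum and \<open>s T\<close> is the whole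
      sum.\<close>
    define s where "s n = (\<Sum>k = T + 1 - n..T. (X k)\<^sup>2)" for n
    define p where "p n = 3 / 2 * (Y (T - n))\<^sup>2" for n
    define q where "q = M\<^sub>g\<^sup>2 * real T * Q"
    have step: "s (Suc n) \<le> s n + p n + 3 * M\<^sub>g\<^sup>2 * (s n)\<^sup>2" if "n < T" for n
    proof -
      define t where "t = T - n"
      have t: "t \<in> {1..T}" "T + 1 - n = t + 1" "T + 1 - Suc n = t"
        using that by (auto simp: t_def)
      have s_Suc: "s (Suc n) = (X t)\<^sup>2 + s n"
        unfolding s_def t using t(1) by (simp add: sum.atLeast_Suc_atMost)
      define z where "z = M\<^sub>g * s n"
      have "X t \<le> Y t + z"
        using assms(5)[OF t(1)] unfolding z_def s_def t(2) by linarith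
      then have "(X t)\<^sup>2 \<le> (Y t + z)\<^sup>2" using assms(2)[OF t(1)] by (intro power_mono)
      \<comment> \<open>The difference of the two sides is (y - 2z)^2 / 2.\<close>
      also have "\<dots> \<le> 3 / 2 * (Y t)\<^sup>2 + 3 * z\<^sup>2"
        using zero_le_power2[of "Y t - 2 * z"] by (simp add: power2_eq_square algebra_simps)
      finally show ?thesis
        by (simp add: s_Suc p_def t_def z_def power_mult_distrib)
    qed
    have sum_p: "(\<Sum>i<T. p i) = 3 / 2 * Q"
    proof -
      have "(\<Sum>i<T. (Y (T - i))\<^sup>2) = Q" unfolding Q_def
        by (rule sum.reindex_bij_witness[of _ "\<lambda>t. T - t" "\<lambda>i. T - i"]) auto
      then show ?thesis unfolding p_def by (metis sum_distrib_left)
    qed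
    have q: "4 * exp 1 * q < 1" using False by (simp add: q_def)
    have TD: "real T * (3 * M\<^sub>g\<^sup>2 * (\<Sum>i<T. p i)) = 9 / 2 * q"
      unfolding sum_p q_def by simp
    have "0 \<le> q" unfolding q_def using Q0 by simp
    then have "21 / 8 * q \<le> exp 1 * q" using exp_1_ge by (rule mult_right_mono[rotated])
    \<comment> \<open>Here (21/2) q \<le> 4 e q < 1.\<close>
    then have q_less: "9 / 2 * q < 1" using q by simp
    have "s T \<le> (\<Sum>i<T. p i) / (1 - real T * (3 * M\<^sub>g\<^sup>2 * (\<Sum>i<T. p i)))"
      by (rule discrete_riccati_bound[where d = "3 * M\<^sub>g\<^sup>2" and N = T])
        (use step q_less TD in \<open>auto simp: s_def p_def sum_nonneg\<close>)
    also have "\<dots> = 3 / 2 / (1 - 9 / 2 * q) * Q"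
      unfolding TD unfolding sum_p by simp
    also have "\<dots> \<le> exp 1 * Q"
    proof (intro mult_right_mono Q0)
      \<comment> \<open>Since 4 e q < 1, e (1 - (9/2) q) = e - (9/8)(4 e q) > e - 9/8 \<ge>
        3/2.\<close>
      show "3 / 2 / (1 - 9 / 2 * q) \<le> exp 1"
        using q q_less exp_1_ge by (simp add: pos_divide_le_eq algebra_simps)
    qed
    also have "\<dots> \<le> m * Q" unfolding m_def using Q0 by (intro mult_right_mono) auto
    finally show ?thesis by (simp add: s_def)
  qed
  then show ?thesis by (simp add: m_def Q_def)
qed

end
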